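(* Let $\gamma$ be a real quadratic irrational, and let $\alpha,\beta\in\mathbb{Q}(\gamma)$ with $\alpha$ irrational and $\alpha>0$. Then the inhomogeneous Beatty sequence $(\lfloor\alpha n+\beta\rfloor)_{n\ge 0}$ forms an asymptotic additive basis of order $h$ for some integer $h\ge 1$. Furthermore, the smallest such $h$ is effectively computable (from $\gamma$ and the rational coordinates of $\alpha,\beta$ with respect to $1,\gamma$), and one can also decide whether $(\lfloor\alpha n+\beta\rfloor)_{n\ge 0}$ forms an additive basis.
   Context: $\mathbb{N}=\{0,1,2,\ldots\}$. For a sequence $s=(s_i)$ of integers and $r\ge 1$, let $$A_s(r)=\{n\in\mathbb{N} : \exists\, i_1,\ldots,i_r \text{ such that } n=s_{i_1}+s_{i_2}+\cdots+s_{i_r}\}$$ (the indices need not be distinct). The sequence forms an additive basis of order $r$ if $A_s(r)=\mathbb{N}$, and an asymptotic additive basis of order $r$ if $\mathbb{N}\setminus A_s(r)$ is finite. It forms an additive basis if it forms an additive basis of order $r$ for some $r\ge 1$. *)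

theory Defs
  imports Complex_Main "HOL-Library.Nat_Bijection"
begin

text \<open>Sums of exactly \<open>r\<close> terms of a sequence. Terms may be negative, but only the
  nonnegative sums are collected.\<close>

definition sums_of :: "(nat \<Rightarrow> int) \<Rightarrow> nat \<Rightarrow> nat set" where
  "sums_of s r = {n. \<exists>i :: nat \<Rightarrow> nat. int n = (\<Sum>k<r. s (i k))}"

definition additive_basis_of_order :: "(nat \<Rightarrow> int) \<Rightarrow> nat \<Rightarrow> bool" where
  "additive_basis_of_order s r \<longleftrightarrow> sums_of s r = UNIV"

definition asymptotic_additive_basis_of_order :: "(nat \<Rightarrow> int) \<Rightarrow> nat \<Rightarrow> bool" where
  "asymptotic_additive_basis_of_order s r \<longleftrightarrow> finite (UNIV - sums_of s r)"

definition additive_basis :: "(nat \<Rightarrow> int) \<Rightarrow> bool" where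
  "additive_basis s \<longleftrightarrow> (\<exists>r\<ge>1. additive_basis_of_order s r)"

definition beatty :: "real \<Rightarrow> real \<Rightarrow> nat \<Rightarrow> int" where
  "beatty \<alpha> \<beta> n = \<lfloor>\<alpha> * real n + \<beta>\<rfloor>"

definition quadratic_irrational :: "real \<Rightarrow> bool" where
  "quadratic_irrational \<gamma> \<longleftrightarrow> \<gamma> \<notin> \<rat> \<and>
     (\<exists>a b c :: int. a \<noteq> 0 \<and> of_int a * \<gamma>\<^sup>2 + of_int b * \<gamma> + of_int c = 0)"

text \<open>Closure under \<open>inverse\<close> needs no side condition, since \<open>inverse 0 = 0\<close>.
  A subfield contains the rationals, so \<open>rat_adjoin \<gamma>\<close> is the field generated by
  \<open>\<gamma>\<close> over them.\<close>

definition is_subfield :: "real set \<Rightarrow> bool" where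
  "is_subfield K \<longleftrightarrow> 0 \<in> K \<and> 1 \<in> K \<and>
     (\<forall>x\<in>K. \<forall>y\<in>K. x + y \<in> K \<and> x * y \<in> K) \<and>
     (\<forall>x\<in>K. - x \<in> K \<and> inverse x \<in> K)"

definition rat_adjoin :: "real \<Rightarrow> real set" where
  "rat_adjoin \<gamma> = is_subfield hull {\<gamma>}"

text \<open>The total recursive functions of \<open>n\<close> arguments: the least class containing zero,
  successor and projections and closed under composition, primitive recursion and
  minimization of regular functions. Arguments are passed as lists; for a function of
  \<open>n\<close> arguments only the values on lists of length \<open>n\<close> are meaningful.\<close>

inductive total_recursive :: "nat \<Rightarrow> (nat list \<Rightarrow> nat) \<Rightarrow> bool" where
  zero: "total_recursive n (\<lambda>xs. 0)"
| succ: "total_recursive 1 (\<lambda>xs. Suc (xs ! 0))"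
| proj: "i < n \<Longrightarrow> total_recursive n (\<lambda>xs. xs ! i)"
| comp: "total_recursive (length gs) f \<Longrightarrow> \<forall>g\<in>set gs. total_recursive n g \<Longrightarrow>
    total_recursive n (\<lambda>xs. f (map (\<lambda>g. g xs) gs))"
| prim_rec: "total_recursive n f \<Longrightarrow> total_recursive (Suc (Suc n)) g \<Longrightarrow>
    total_recursive (Suc n)
      (\<lambda>xs. rec_nat (f (tl xs)) (\<lambda>k r. g (k # r # tl xs)) (hd xs))"
| minim: "total_recursive (Suc n) f \<Longrightarrow>
    \<forall>xs. length xs = n \<longrightarrow> (\<exists>y. f (y # xs) = 0) \<Longrightarrow>
    total_recursive n (\<lambda>xs. LEAST y. f (y # xs) = 0)"

text \<open>Finite data for a quadratic irrational \<open>\<gamma>\<close>: an integer quadratic polynomial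
  with root \<open>\<gamma>\<close>, not necessarily primitive, together with the sign of its derivative
  at \<open>\<gamma>\<close>. The derivative has opposite signs at the two roots, so the sign
  \<open>\<sigma>\<close> singles out \<open>\<gamma> = (- b + \<sigma> * sqrt (b\<^sup>2 - 4 * a * c)) / (2 * a)\<close>.\<close>

definition describes :: "int \<Rightarrow> int \<Rightarrow> int \<Rightarrow> int \<Rightarrow> real \<Rightarrow> bool" where
  "describes a b c \<sigma> \<gamma> \<longleftrightarrow> a \<noteq> 0 \<and>
     of_int a * \<gamma>\<^sup>2 + of_int b * \<gamma> + of_int c = 0 \<and>
     of_int \<sigma> = sgn (2 * of_int a * \<gamma> + of_int b)"

text \<open>Integers are coded by the bijection \<open>int_encode\<close>, rationals by
  numerator and denominator in lowest terms.\<close>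

definition rat_data :: "rat \<Rightarrow> int list" where
  "rat_data x = [fst (quotient_of x), snd (quotient_of x)]"

definition input_code ::
  "int \<Rightarrow> int \<Rightarrow> int \<Rightarrow> int \<Rightarrow> rat \<Rightarrow> rat \<Rightarrow> rat \<Rightarrow> rat \<Rightarrow> nat list" where
  "input_code a b c \<sigma> p q u v =
     map int_encode ([a, b, c, \<sigma>] @ rat_data p @ rat_data q @ rat_data u @ rat_data v)"

text \<open>The inputs: data for \<open>\<gamma>\<close> and the coordinates of
  \<open>\<alpha> = p + q * \<gamma>\<close> and \<open>\<beta> = u + v * \<gamma>\<close>.\<close>

definition input_for ::
  "nat list \<Rightarrow> real \<Rightarrow> real \<Rightarrow> real \<Rightarrow> bool" where
  "input_for xs \<gamma> \<alpha> \<beta> \<longleftrightarrow> (\<exists>a b c \<sigma> p q u v.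
     xs = input_code a b c \<sigma> p q u v \<and> describes a b c \<sigma> \<gamma> \<and>
     \<alpha> = of_rat p + of_rat q * \<gamma> \<and> \<beta> = of_rat u + of_rat v * \<gamma>)"

end

theory Submission
  imports Defs "HOL-Analysis.Kronecker_Approximation_Theorem"
begin

text \<open>The least order is \<open>\<lfloor>\<alpha>\<rfloor> + 1\<close>. A sum of \<open>h\<close> terms with index sum \<open>N\<close> lies within
  \<open>h\<close> below \<open>\<alpha> * N + h * \<beta>\<close>, so when \<open>h < \<alpha>\<close> the sums leave gaps, infinitely many of them by
  Kronecker's theorem. Conversely, choose \<open>a\<close> and \<open>b\<close> at which the fractional part of
  \<open>\<alpha> * n + \<beta>\<close> is close to \<open>0\<close> and to \<open>1\<close>. Replacing \<open>b\<close> by \<open>a\<close> one index at a time, with a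
  last index that keeps the index sum \<open>N\<close>, changes the sum in steps of at most one, and the
  intervals swept out for consecutive \<open>N\<close> leave no gap when \<open>h > \<alpha>\<close>.

  The sequence is an additive basis iff \<open>s 0 < 0\<close>, or \<open>s 0 = 0\<close> and \<open>s 1 \<le> 1\<close>. In terms of
  \<open>\<alpha>\<close> and \<open>\<beta>\<close> this, like the order, depends only on the signs of numbers \<open>r + r' * \<gamma>\<close> with
  rational \<open>r\<close> and \<open>r'\<close>, and \<open>W + V * sqrt D > 0\<close> is equivalent to
  \<open>W * \<bar>W\<bar> + V * \<bar>V\<bar> * D > 0\<close>.\<close>

subsection \<open>Sums of Beatty sequences\<close>

text \<open>Unlike in \<open>sums_of\<close>, negative totals are kept, so that partial sums of any
  sign can be combined.\<close>

definition is_sum_of :: "(nat \<Rightarrow> int) \<Rightarrow> nat \<Rightarrow> int \<Rightarrow> bool" where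
  "is_sum_of s r m \<longleftrightarrow> (\<exists>i :: nat \<Rightarrow> nat. m = (\<Sum>k<r. s (i k)))"

lemma mem_sums_of_iff: "n \<in> sums_of s r \<longleftrightarrow> is_sum_of s r (int n)"
  by (simp add: sums_of_def is_sum_of_def)

lemma is_sum_of_1: "is_sum_of s 1 (s n)"
  unfolding is_sum_of_def by (rule exI[of _ "\<lambda>_. n"]) simp

lemma is_sum_of_add:
  assumes "is_sum_of s r m" "is_sum_of s q l"
  shows "is_sum_of s (r + q) (m + l)"
proof -
  obtain i j where ij: "m = (\<Sum>k<r. s (i k))" "l = (\<Sum>k<q. s (j k))"
    using assms by (auto simp: is_sum_of_def)
  define f where "f k = (if k < r then i k else j (k - r))" for k
  have "(\<Sum>k<r + p. s (f k)) = m + (\<Sum>k<p. s (j k))" for p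
    by (induction p) (auto simp: f_def ij)
  from this[of q] show ?thesis
    unfolding is_sum_of_def ij(2)[symmetric] by metis
qed

lemma is_sum_of_mult: "is_sum_of s r (int r * s n)"
  unfolding is_sum_of_def by (rule exI[of _ "\<lambda>_. n"]) simp

text \<open>Kronecker's theorem is aimed at the midpoint of the interval, shifted back by
  \<open>c\<close> and \<open>\<theta> * K\<close>, and the index found is then raised by
  \<open>K\<close>. The error is less than half the length of the interval, so the value does not
  wrap around modulo 1.\<close>

lemma frac_dense:
  fixes \<theta> c u v :: real
  assumes "\<theta> \<notin> \<rat>" "0 \<le> u" "u < v" "v \<le> 1"
  obtains k where "k \<ge> K" "u < frac (\<theta> * real k + c)" "frac (\<theta> * real k + c) < v"
proof -
  define b where "b = (u + v) / 2 - c - \<theta> * real K"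
  obtain k where k: "\<bar>frac (real k * \<theta>) - frac b\<bar> < (v - u) / 2"
    using Kronecker_approx_1_explicit[of \<theta> "frac b" "(v - u) / 2"] assms
      frac_ge_0[of b] frac_lt_1[of b] by auto
  define e where "e = frac (real k * \<theta>) - frac b"
  have "\<theta> * real (k + K) + c - ((u + v) / 2 + e) = of_int (\<lfloor>real k * \<theta>\<rfloor> - \<lfloor>b\<rfloor>)"
    unfolding e_def b_def frac_def by (simp add: algebra_simps)
  then have *: "\<theta> * real (k + K) + c - ((u + v) / 2 + e) \<in> \<int>"
    by (metis Ints_of_int)
  have e: "- (v - u) / 2 < e" "e < (v - u) / 2"
    using k unfolding e_def by linarith+
  have "frac (\<theta> * real (k + K) + c) = (u + v) / 2 + e"
    unfolding frac_unique_iff using * e assms by (auto simp: field_simps)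
  then show thesis
    using that[of "k + K"] e by (simp add: field_simps)
qed

section \<open>Representing all large integers\<close>

lemma beatty_eq: "real_of_int (beatty \<alpha> \<beta> n) = \<alpha> * real n + \<beta> - frac (\<alpha> * real n + \<beta>)"
  by (simp add: beatty_def frac_def)

lemma beatty_le: "real_of_int (beatty \<alpha> \<beta> n) \<le> \<alpha> * real n + \<beta>"
  by (simp add: beatty_def)

text \<open>The index sums \<open>a + y\<close> and \<open>b + x\<close> agree, so the linear parts
  cancel and only four fractional parts remain. Their combination is an integer strictly between -1
  and 2.\<close>

lemma beatty_exchange:
  assumes "frac (\<alpha> * real a + \<beta>) \<le> frac (\<alpha> * real b + \<beta>)" "x + b = y + a"
  shows "beatty \<alpha> \<beta> a + beatty \<alpha> \<beta> y - (beatty \<alpha> \<beta> b + beatty \<alpha> \<beta> x) \<in> {0, 1}"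
proof -
  define d where "d = beatty \<alpha> \<beta> a + beatty \<alpha> \<beta> y - (beatty \<alpha> \<beta> b + beatty \<alpha> \<beta> x)"
  have "real x + real b = real y + real a"
    using assms(2) by (metis of_nat_add)
  then have "\<alpha> * real x + \<alpha> * real b = \<alpha> * real y + \<alpha> * real a"
    by (metis distrib_left)
  then have "real_of_int d = frac (\<alpha> * real b + \<beta>) - frac (\<alpha> * real a + \<beta>)
      + frac (\<alpha> * real x + \<beta>) - frac (\<alpha> * real y + \<beta>)"
    by (simp add: d_def beatty_eq)
  then have "- 1 < real_of_int d" "real_of_int d < 2"
    using assms(1) frac_lt_1[of "\<alpha> * real b + \<beta>"] frac_ge_0[of "\<alpha> * real a + \<beta>"]
      frac_lt_1[of "\<alpha> * real x + \<beta>"] frac_ge_0[of "\<alpha> * real x + \<beta>"]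
      frac_lt_1[of "\<alpha> * real y + \<beta>"] frac_ge_0[of "\<alpha> * real y + \<beta>"] by linarith+
  then have "d = 0 \<or> d = 1"
    by linarith
  then show ?thesis
    by (simp add: d_def)
qed

lemma beatty_sums_interval:
  assumes "frac (\<alpha> * real a + \<beta>) \<le> frac (\<alpha> * real b + \<beta>)" "H * (a + b) \<le> N"
    and lo: "int H * beatty \<alpha> \<beta> b + beatty \<alpha> \<beta> (N - H * b) \<le> m"
    and hi: "m \<le> int H * beatty \<alpha> \<beta> a + beatty \<alpha> \<beta> (N - H * a)"
  shows "is_sum_of (beatty \<alpha> \<beta>) (Suc H) m"
proof -
  define s where "s = beatty \<alpha> \<beta>"
  define I where "I k = k * a + (H - k) * b" for k
  \<comment> \<open>\<open>k\<close> counts the copies of \<open>b\<close> already replaced by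
    \<open>a\<close>; the last index \<open>N - I k\<close> brings the index sum back to
    \<open>N\<close>.\<close>
  define T where "T k = int k * s a + int (H - k) * s b + s (N - I k)" for k
  \<comment> \<open>This keeps the natural subtraction \<open>N - I k\<close> from being
    truncated.\<close>
  have I_le: "I k \<le> N" if "k \<le> H" for k
  proof -
    have "I k \<le> H * a + H * b"
      unfolding I_def using that by (intro add_mono mult_le_mono1) auto
    then show ?thesis
      using assms(2) by (simp add: distrib_left)
  qed
  have step: "\<bar>T (Suc k) - T k\<bar> \<le> 1" if "k < H" for k
  proof -
    obtain j where j: "H = Suc (k + j)"
      using \<open>k < H\<close> by (metis less_iff_Suc_add)
    have "(N - I k) + b = (N - I (Suc k)) + a"
      using I_le[of k] I_le[of "Suc k"] by (simp add: I_def j)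
    from beatty_exchange[OF assms(1) this] show ?thesis
      by (auto simp: T_def s_def j algebra_simps)
  qed
  have "T 0 \<le> m" "m \<le> T H"
    using lo hi by (simp_all add: T_def I_def s_def)
  then obtain k where k: "k \<le> H" "T k = m"
    using nat0_intermed_int_val[of H T m] step by auto
  have "is_sum_of s (k + (H - k) + 1) (T k)"
    unfolding T_def by (intro is_sum_of_add is_sum_of_mult is_sum_of_1)
  then show ?thesis
    using k by (simp add: s_def)
qed

lemma beatty_sums_eventually:
  fixes \<alpha> \<beta> :: real
  assumes "\<alpha> \<notin> \<rat>" "\<alpha> > 0" "\<alpha> < real h"
  obtains M :: int where "\<And>m. m \<ge> M \<Longrightarrow> is_sum_of (beatty \<alpha> \<beta>) h m"
proof -
  obtain H where H: "h = Suc H"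
    using assms by (cases h) auto
  \<comment> \<open>\<open>e\<close> bounds the error of the \<open>H\<close> terms at
    \<open>a\<close> or at \<open>b\<close>. It enters at both ends of the interval, so
    \<open>\<delta>\<close> is scaled to make \<open>2 * e\<close> at most the slack
    \<open>h - \<alpha>\<close>.\<close>
  define \<delta> where "\<delta> = (real h - \<alpha>) / (2 * real h)"
  define e where "e = real H * \<delta>"
  have \<delta>: "\<delta> > 0" "\<delta> \<le> 1 / 2"
    using assms by (auto simp: \<delta>_def field_simps)
  have e: "e \<ge> 0" "2 * e \<le> real h - \<alpha>"
  proof -
    have "2 * e = real H / real h * (real h - \<alpha>)"
      by (simp add: e_def \<delta>_def)
    also have "\<dots> \<le> 1 * (real h - \<alpha>)"
      using assms H by (intro mult_right_mono) auto
    finally show "2 * e \<le> real h - \<alpha>"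
      by simp
    show "e \<ge> 0"
      using \<delta> by (simp add: e_def)
  qed
  obtain a where a: "frac (\<alpha> * real a + \<beta>) < \<delta>"
    using frac_dense[of \<alpha> 0 \<delta> 0 \<beta>] assms \<delta> by auto
  obtain b where b: "1 - \<delta> < frac (\<alpha> * real b + \<beta>)"
    using frac_dense[of \<alpha> "1 - \<delta>" 1 0 \<beta>] assms \<delta> by auto
  \<comment> \<open>This forces \<open>t \<ge> H * (a + b)\<close> below, which leaves room for the
    last indices \<open>N - H * a\<close> and \<open>N - H * b\<close>.\<close>
  define M where "M = \<lceil>\<alpha> * real (H * (a + b)) + real h * \<beta>\<rceil>"
  have "is_sum_of (beatty \<alpha> \<beta>) h m" if "m \<ge> M" for m
  proof -
    \<comment> \<open>\<open>N\<close> is the least natural number with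
      \<open>\<alpha> * N + h * \<beta> \<ge> m + e\<close>; by minimality the excess over
      \<open>m + e\<close> is less than \<open>\<alpha>\<close>.\<close>
    define t where "t = (real_of_int m - real h * \<beta> + e) / \<alpha>"
    define N where "N = nat \<lceil>t\<rceil>"
    have "\<alpha> * real (H * (a + b)) + real h * \<beta> \<le> real_of_int m"
      using that by (simp add: M_def ceiling_le_iff)
    then have "real (H * (a + b)) \<le> t"
      using assms e unfolding t_def by (simp add: field_simps)
    moreover from this have "t \<ge> 0"
      by (meson of_nat_0_le_iff order_trans)
    ultimately have "t \<le> real N" "real N < t + 1" and N: "H * (a + b) \<le> N"
      unfolding N_def by linarith+
    then have aN: "real_of_int m + e \<le> \<alpha> * real N + real h * \<beta>"
        "\<alpha> * real N + real h * \<beta> < real_of_int m + e + \<alpha>"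
      using assms by (simp_all add: t_def field_simps)
    have "H * a \<le> N" "H * b \<le> N"
      using N by (auto simp: distrib_left)
    then have Na: "real (N - H * a) = real N - real H * real a"
        and Nb: "real (N - H * b) = real N - real H * real b"
      by (simp_all add: of_nat_diff)
    \<comment> \<open>At the end built from \<open>a\<close>, rounding loses at most
      \<open>e\<close> in the first \<open>H\<close> terms and less than one in the last, so the sum
      exceeds \<open>m - 1\<close>.\<close>
    have "real H * frac (\<alpha> * real a + \<beta>) \<le> e"
      unfolding e_def using a by (intro mult_left_mono) auto
    then have "real_of_int m - 1 < real_of_int (int H * beatty \<alpha> \<beta> a + beatty \<alpha> \<beta> (N - H * a))"
      using frac_lt_1[of "\<alpha> * real (N - H * a) + \<beta>"] aN
      by (simp add: beatty_eq Na H algebra_simps)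
    then have hi: "m \<le> int H * beatty \<alpha> \<beta> a + beatty \<alpha> \<beta> (N - H * a)"
      by linarith
    \<comment> \<open>At the end built from \<open>b\<close>, rounding loses at least
      \<open>H - e\<close>. Since \<open>2 * e \<le> H + 1 - \<alpha>\<close>, the sum stays below
      \<open>m + 1\<close>.\<close>
    have "real H * (1 - frac (\<alpha> * real b + \<beta>)) \<le> e"
      unfolding e_def using b by (intro mult_left_mono) auto
    then have "real_of_int (int H * beatty \<alpha> \<beta> b + beatty \<alpha> \<beta> (N - H * b)) < real_of_int m + 1"
      using beatty_le[of \<alpha> \<beta> "N - H * b"] aN e
      by (simp add: beatty_eq[of \<alpha> \<beta> b] Nb H algebra_simps)
    then have lo: "int H * beatty \<alpha> \<beta> b + beatty \<alpha> \<beta> (N - H * b) \<le> m"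
      by linarith
    show ?thesis
      unfolding H using a b \<delta> by (intro beatty_sums_interval[OF _ N lo hi]) linarith
  qed
  then show thesis
    by (rule that)
qed

section \<open>Gaps when the order is too small\<close>

text \<open>For \<open>N\<close> the sum of the indices, rounding loses a sum of \<open>h\<close>
  fractional parts, which lies between \<open>0\<close> and \<open>h\<close>.\<close>

lemma beatty_sum_bounds:
  assumes "is_sum_of (beatty \<alpha> \<beta>) h m"
  obtains N :: nat where "real_of_int m \<le> \<alpha> * real N + real h * \<beta>"
    "\<alpha> * real N + real h * \<beta> \<le> real_of_int m + real h"
proof -
  obtain i where i: "m = (\<Sum>k<h. beatty \<alpha> \<beta> (i k))"
    using assms by (auto simp: is_sum_of_def)
  define F where "F = (\<Sum>k<h. frac (\<alpha> * real (i k) + \<beta>))"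
  have "0 \<le> F"
    unfolding F_def by (intro sum_nonneg) auto
  moreover have "F \<le> (\<Sum>k<h. 1)"
    unfolding F_def by (intro sum_mono) (simp add: frac_lt_1 less_imp_le)
  moreover have "real_of_int m = \<alpha> * real (\<Sum>k<h. i k) + real h * \<beta> - F"
    by (simp add: i F_def beatty_eq sum.distrib sum_subtractf sum_distrib_left)
  ultimately show thesis
    using that[of "\<Sum>k<h. i k"] by simp
qed

text \<open>The interval of length \<open>h / \<alpha> < 1\<close> that begins at \<open>(m - h * \<beta>) / \<alpha>\<close> contains
  no integer for infinitely many \<open>m\<close>.\<close>

lemma beatty_sums_gaps:
  fixes \<alpha> \<beta> :: real
  assumes "\<alpha> \<notin> \<rat>" "\<alpha> > 0" "real h < \<alpha>"
  obtains m where "m \<ge> K" "m \<notin> sums_of (beatty \<alpha> \<beta>) h"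
proof -
  have "1 / \<alpha> \<notin> \<rat>"
    using assms by (metis Rats_inverse inverse_eq_divide inverse_inverse_eq)
  then obtain m where m: "m \<ge> K" "0 < frac (1 / \<alpha> * real m + - (real h * \<beta>) / \<alpha>)"
      "frac (1 / \<alpha> * real m + - (real h * \<beta>) / \<alpha>) < 1 - real h / \<alpha>"
    using frac_dense[of "1 / \<alpha>" 0 "1 - real h / \<alpha>" K "- (real h * \<beta>) / \<alpha>"] assms by auto
  define t where "t = 1 / \<alpha> * real m + - (real h * \<beta>) / \<alpha>"
  have t: "\<alpha> * t = real m - real h * \<beta>"
    using assms by (simp add: t_def field_simps)
  have "\<not> is_sum_of (beatty \<alpha> \<beta>) h (int m)"
  proof
    assume "is_sum_of (beatty \<alpha> \<beta>) h (int m)"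
    then obtain N :: nat where "real m \<le> \<alpha> * real N + real h * \<beta>"
        "\<alpha> * real N + real h * \<beta> \<le> real m + real h"
      by (auto elim: beatty_sum_bounds)
    then have "\<alpha> * t \<le> \<alpha> * real N" "\<alpha> * real N \<le> \<alpha> * (t + real h / \<alpha>)"
      using assms by (auto simp: t distrib_left)
    then have "t \<le> real N" "real N \<le> t + real h / \<alpha>"
      using assms by (auto simp: mult_le_cancel_left_pos)
    \<comment> \<open>A fractional part strictly between \<open>0\<close> and
      \<open>1 - h / \<alpha>\<close> keeps all of \<open>[t, t + h / \<alpha>]\<close> strictly
      between consecutive integers.\<close>
    moreover have "of_int \<lfloor>t\<rfloor> < t" "t < of_int \<lfloor>t\<rfloor> + 1 - real h / \<alpha>"
      using m(2,3) unfolding t_def[symmetric] frac_def by linarith+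
    ultimately have "real_of_int \<lfloor>t\<rfloor> < real_of_int (int N)"
        "real_of_int (int N) < real_of_int (\<lfloor>t\<rfloor> + 1)"
      by simp_all
    then show False
      unfolding of_int_less_iff by linarith
  qed
  then show thesis
    using m(1) that by (simp add: mem_sums_of_iff)
qed

text \<open>Irrationality excludes the boundary case \<open>h = \<alpha>\<close>, so either the gaps
  or the eventual representations apply.\<close>

lemma asymptotic_basis_beatty_iff:
  fixes \<alpha> \<beta> :: real
  assumes "\<alpha> \<notin> \<rat>" "\<alpha> > 0"
  shows "asymptotic_additive_basis_of_order (beatty \<alpha> \<beta>) h \<longleftrightarrow> \<alpha> < real h"
proof
  assume fin: "asymptotic_additive_basis_of_order (beatty \<alpha> \<beta>) h"
  have "real h \<noteq> \<alpha>"
    using assms(1) by auto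
  moreover have "\<not> real h < \<alpha>"
  proof
    assume "real h < \<alpha>"
    then have "\<exists>m\<ge>K. m \<in> UNIV - sums_of (beatty \<alpha> \<beta>) h" for K
      using beatty_sums_gaps[OF assms, of h K \<beta>] by auto
    then have "infinite (UNIV - sums_of (beatty \<alpha> \<beta>) h)"
      by (simp add: infinite_nat_iff_unbounded_le)
    then show False
      using fin by (simp add: asymptotic_additive_basis_of_order_def)
  qed
  ultimately show "\<alpha> < real h"
    by simp
next
  assume "\<alpha> < real h"
  then obtain M where "\<And>m. m \<ge> M \<Longrightarrow> is_sum_of (beatty \<alpha> \<beta>) h m"
    using beatty_sums_eventually[OF assms] by metis
  then have "UNIV - sums_of (beatty \<alpha> \<beta>) h \<subseteq> {..<nat M}"
    by (auto simp: mem_sums_of_iff not_le[symmetric] nat_le_iff)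
  then show "asymptotic_additive_basis_of_order (beatty \<alpha> \<beta>) h"
    unfolding asymptotic_additive_basis_of_order_def by (rule finite_subset) simp
qed

section \<open>Representing every natural number\<close>

lemma beatty_mono: "\<alpha> > 0 \<Longrightarrow> m \<le> n \<Longrightarrow> beatty \<alpha> \<beta> m \<le> beatty \<alpha> \<beta> n"
  unfolding beatty_def by (intro floor_mono) simp

lemma additive_basisI:
  assumes "r \<ge> 1" "\<And>n. is_sum_of s r (int n)"
  shows "additive_basis s"
  using assms by (auto simp: additive_basis_def additive_basis_of_order_def mem_sums_of_iff)

text \<open>Splitting off \<open>j\<close> copies of \<open>s 0 < 0\<close> reduces \<open>n\<close> to \<open>n - j * s 0\<close>, which is large for all
  \<open>n\<close> at once.\<close>

lemma additive_basis_beatty_neg: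
  fixes \<alpha> \<beta> :: real
  assumes "\<alpha> \<notin> \<rat>" "\<alpha> > 0" "\<beta> < 0"
  shows "additive_basis (beatty \<alpha> \<beta>)"
proof -
  define h where "h = Suc (nat \<lfloor>\<alpha>\<rfloor>)"
  have "\<alpha> < real h"
    unfolding h_def by linarith
  then obtain M where M: "\<And>m. m \<ge> M \<Longrightarrow> is_sum_of (beatty \<alpha> \<beta>) h m"
    using beatty_sums_eventually[OF assms(1,2)] by metis
  define j where "j = nat M"
  have neg: "beatty \<alpha> \<beta> 0 \<le> -1"
    using assms(3) by (simp add: beatty_def) linarith
  have "is_sum_of (beatty \<alpha> \<beta>) (h + j) (int n)" for n
  proof -
    have "int j * beatty \<alpha> \<beta> 0 \<le> int j * (- 1)"
      using neg by (intro mult_left_mono) auto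
    then have "is_sum_of (beatty \<alpha> \<beta>) h (int n - int j * beatty \<alpha> \<beta> 0)"
      by (intro M) (auto simp: j_def)
    from is_sum_of_add[OF this is_sum_of_mult[of "beatty \<alpha> \<beta>" j 0]] show ?thesis
      by simp
  qed
  then show ?thesis
    by (intro additive_basisI[of "h + j"]) (simp_all add: h_def)
qed

text \<open>The value 0 serves as padding and the value 1 is attained. An \<open>n\<close> below the
  threshold \<open>M\<close> is a sum of \<open>n\<close> ones and otherwise zeros; larger
  \<open>n\<close> use \<open>h\<close> terms and \<open>j\<close> zeros. Both sums have
  \<open>h + j\<close> terms.\<close>

lemma additive_basis_beatty_zero:
  fixes \<alpha> \<beta> :: real
  assumes "\<alpha> \<notin> \<rat>" "\<alpha> > 0" "0 \<le> \<beta>" "\<beta> < 1" "\<alpha> + \<beta> < 2"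
  shows "additive_basis (beatty \<alpha> \<beta>)"
proof -
  define h where "h = Suc (nat \<lfloor>\<alpha>\<rfloor>)"
  have "\<alpha> < real h"
    unfolding h_def by linarith
  then obtain M where M: "\<And>m. m \<ge> M \<Longrightarrow> is_sum_of (beatty \<alpha> \<beta>) h m"
    using beatty_sums_eventually[OF assms(1,2)] by metis
  have zero: "beatty \<alpha> \<beta> 0 = 0"
    using assms by (simp add: beatty_def floor_eq_iff)
  \<comment> \<open>For \<open>\<alpha> < 1\<close> the least \<open>n\<close> with
    \<open>\<alpha> * n + \<beta> \<ge> 1\<close> overshoots by less than \<open>\<alpha>\<close>,
    hence stays below 2; for \<open>\<alpha> \<ge> 1\<close> the index 1 works.\<close>
  obtain n1 where one: "beatty \<alpha> \<beta> n1 = 1"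
  proof (cases "\<alpha> < 1")
    case True
    define n where "n = nat \<lceil>(1 - \<beta>) / \<alpha>\<rceil>"
    have "0 \<le> (1 - \<beta>) / \<alpha>"
      using assms by simp
    then have "(1 - \<beta>) / \<alpha> \<le> real n" "real n < (1 - \<beta>) / \<alpha> + 1"
      unfolding n_def by linarith+
    then have "1 \<le> \<alpha> * real n + \<beta>" "\<alpha> * real n + \<beta> < 2"
      using assms True by (simp_all add: field_simps)
    then show thesis
      by (intro that[of n]) (simp add: beatty_def floor_eq_iff)
  next
    case False
    then show thesis
      using assms by (intro that[of 1]) (simp add: beatty_def floor_eq_iff)
  qed
  define j where "j = nat M"
  have "is_sum_of (beatty \<alpha> \<beta>) (h + j) (int n)" for n
  proof (cases "int n \<ge> M")
    case True
    from is_sum_of_add[OF M[OF True] is_sum_of_mult[of _ j 0]] show ?thesis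
      by (simp add: zero)
  next
    case False
    then have "n \<le> j"
      by (simp add: j_def)
    moreover have "is_sum_of (beatty \<alpha> \<beta>) (n + (h + (j - n)))
        (int n * beatty \<alpha> \<beta> n1 + int (h + (j - n)) * beatty \<alpha> \<beta> 0)"
      by (intro is_sum_of_add is_sum_of_mult)
    ultimately show ?thesis
      by (simp add: one zero add.commute add.left_commute)
  qed
  then show ?thesis
    by (intro additive_basisI[of "h + j"]) (simp_all add: h_def)
qed

text \<open>Necessity comes from the representations of 0 and 1 alone: if the condition fails, one
  of them is impossible.\<close>

lemma additive_basis_beatty_iff:
  fixes \<alpha> \<beta> :: real
  assumes "\<alpha> \<notin> \<rat>" "\<alpha> > 0"
  shows "additive_basis (beatty \<alpha> \<beta>) \<longleftrightarrow> \<beta> < 0 \<or> \<beta> < 1 \<and> \<alpha> + \<beta> < 2"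
proof
  assume "additive_basis (beatty \<alpha> \<beta>)"
  then obtain r where "r \<ge> 1" and r: "\<And>n. is_sum_of (beatty \<alpha> \<beta>) r (int n)"
    by (auto simp: additive_basis_def additive_basis_of_order_def mem_sums_of_iff[symmetric])
  obtain i where i: "0 = (\<Sum>k<r. beatty \<alpha> \<beta> (i k))"
    using r[of 0] by (auto simp: is_sum_of_def)
  obtain j where j: "1 = (\<Sum>k<r. beatty \<alpha> \<beta> (j k))"
    using r[of 1] by (auto simp: is_sum_of_def)
  show "\<beta> < 0 \<or> \<beta> < 1 \<and> \<alpha> + \<beta> < 2"
  proof (rule disjCI)
    assume "\<not> (\<beta> < 1 \<and> \<alpha> + \<beta> < 2)"
    then consider "\<beta> \<ge> 1" | "\<alpha> + \<beta> \<ge> 2"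
      by linarith
    then show "\<beta> < 0"
    proof cases
      case 1
      then have "1 \<le> beatty \<alpha> \<beta> 0"
        by (simp add: beatty_def)
      then have "1 \<le> beatty \<alpha> \<beta> n" for n
        using beatty_mono[OF assms(2), of 0 n \<beta>] by simp
      then have "(\<Sum>k<r. 1) \<le> (\<Sum>k<r. beatty \<alpha> \<beta> (i k))"
        by (intro sum_mono)
      then show ?thesis
        using i \<open>r \<ge> 1\<close> by simp
    next
      case 2
      show ?thesis
      proof (rule ccontr)
        assume "\<not> \<beta> < 0"
        then have nonneg: "0 \<le> beatty \<alpha> \<beta> n" for n
          using assms by (simp add: beatty_def le_floor_iff)
        have "2 \<le> beatty \<alpha> \<beta> 1"
          using 2 by (simp add: beatty_def le_floor_iff)
        then have big: "2 \<le> beatty \<alpha> \<beta> n" if "n \<ge> 1" for n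
          using beatty_mono[OF assms(2) that, of \<beta>] by simp
        \<comment> \<open>Nonnegative terms with sum 1 are at most 1, which leaves only the index 0.
          Then \<open>r\<close> copies of the initial term add up to 1, so that term is positive and
          0 is not a sum.\<close>
        have "beatty \<alpha> \<beta> (j k) \<le> 1" if "k < r" for k
          using member_le_sum[of k "{..<r}" "\<lambda>k. beatty \<alpha> \<beta> (j k)"] nonneg j that by simp
        then have "j k = 0" if "k < r" for k
          using big[of "j k"] that by (cases "j k = 0") fastforce+
        then have "1 = int r * beatty \<alpha> \<beta> 0"
          using j by simp
        then have "beatty \<alpha> \<beta> 0 \<noteq> 0"
          by auto
        then have "1 \<le> beatty \<alpha> \<beta> n" for n
          using nonneg[of 0] beatty_mono[OF assms(2), of 0 n \<beta>] by simp
        then have "(\<Sum>k<r. 1) \<le> (\<Sum>k<r. beatty \<alpha> \<beta> (i k))"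
          by (intro sum_mono)
        then show False
          using i \<open>r \<ge> 1\<close> by simp
      qed
    qed
  qed
next
  assume "\<beta> < 0 \<or> \<beta> < 1 \<and> \<alpha> + \<beta> < 2"
  then show "additive_basis (beatty \<alpha> \<beta>)"
    using additive_basis_beatty_neg additive_basis_beatty_zero assms by (cases "\<beta> < 0") auto
qed

subsection \<open>Computable functions\<close>

text \<open>Agreement on lists of length \<open>n\<close> only, since \<open>total_recursive\<close> prescribes
  the values also on lists of other lengths.\<close>

definition computable :: "nat \<Rightarrow> (nat list \<Rightarrow> nat) \<Rightarrow> bool" where
  "computable n f \<longleftrightarrow> (\<exists>f'. total_recursive n f' \<and> (\<forall>xs. length xs = n \<longrightarrow> f xs = f' xs))"

lemma computable_cong:
  assumes "\<And>xs. length xs = n \<Longrightarrow> f xs = g xs"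
  shows "computable n f \<longleftrightarrow> computable n g"
  using assms by (auto simp: computable_def)

lemma computable_nth: "i < n \<Longrightarrow> computable n (\<lambda>xs. xs ! i)"
  unfolding computable_def using total_recursive.proj by blast

lemma computable_comp:
  assumes "computable (length gs) f" "\<forall>g\<in>set gs. computable n g"
  shows "computable n (\<lambda>xs. f (map (\<lambda>g. g xs) gs))"
proof -
  obtain f' where f': "total_recursive (length gs) f'"
      "\<And>xs. length xs = length gs \<Longrightarrow> f xs = f' xs"
    using assms(1) by (auto simp: computable_def)
  obtain t where t: "\<And>g. g \<in> set gs \<Longrightarrow> total_recursive n (t g)"
      "\<And>g xs. g \<in> set gs \<Longrightarrow> length xs = n \<Longrightarrow> g xs = t g xs"
    using assms(2) unfolding computable_def by metis
  have "total_recursive n (\<lambda>xs. f' (map (\<lambda>g. g xs) (map t gs)))"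
    using f'(1) t(1) by (intro total_recursive.comp) auto
  moreover have "f (map (\<lambda>g. g xs) gs) = f' (map (\<lambda>g. g xs) (map t gs))" if "length xs = n" for xs
  proof -
    have "map (\<lambda>g. g xs) gs = map (\<lambda>g. g xs) (map t gs)"
      by (simp add: t(2) that)
    moreover have "f (map (\<lambda>g. g xs) gs) = f' (map (\<lambda>g. g xs) gs)"
      by (simp add: f'(2))
    ultimately show ?thesis
      by (simp only:)
  qed
  ultimately show ?thesis
    unfolding computable_def by blast
qed

lemma computable_comp1:
  assumes "computable 1 (\<lambda>ys. F (ys ! 0))" "computable n f"
  shows "computable n (\<lambda>xs. F (f xs))"
  using computable_comp[of "[f]" "\<lambda>ys. F (ys ! 0)" n] assms by simp

lemma computable_comp2:
  assumes "computable 2 (\<lambda>ys. F (ys ! 0) (ys ! 1))" "computable n f" "computable n g"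
  shows "computable n (\<lambda>xs. F (f xs) (g xs))"
  using computable_comp[of "[f, g]" "\<lambda>ys. F (ys ! 0) (ys ! 1)" n] assms
  by (simp add: numeral_2_eq_2)

lemma computable_Suc:
  assumes "computable n f"
  shows "computable n (\<lambda>xs. Suc (f xs))"
proof (rule computable_comp1[of Suc, OF _ assms])
  show "computable 1 (\<lambda>ys. Suc (ys ! 0))"
    unfolding computable_def using total_recursive.succ by blast
qed

lemma computable_const: "computable n (\<lambda>xs. c)"
proof (induction c)
  case 0
  show ?case
    unfolding computable_def using total_recursive.zero by blast
qed (rule computable_Suc)

lemma computable_rec_nat:
  assumes "computable n f" "computable (Suc (Suc n)) g"
  shows "computable (Suc n) (\<lambda>xs. rec_nat (f (tl xs)) (\<lambda>k r. g (k # r # tl xs)) (hd xs))"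
proof -
  obtain f' g' where fg: "total_recursive n f'" "total_recursive (Suc (Suc n)) g'"
      "\<And>xs. length xs = n \<Longrightarrow> f xs = f' xs" "\<And>xs. length xs = Suc (Suc n) \<Longrightarrow> g xs = g' xs"
    using assms by (auto simp: computable_def)
  have "rec_nat (f ys) (\<lambda>k r. g (k # r # ys)) y = rec_nat (f' ys) (\<lambda>k r. g' (k # r # ys)) y"
    if "length ys = n" for ys y
    using that by (induction y) (auto simp: fg)
  then show ?thesis
    unfolding computable_def using total_recursive.prim_rec[OF fg(1,2)] by fastforce
qed

text \<open>This recasts the \<open>hd\<close> and \<open>tl\<close> form of primitive recursion so
  that the recursion argument may be any computable function.\<close>

lemma computable_rec1:
  assumes "computable 2 (\<lambda>ys. G (ys ! 0) (ys ! 1))" "computable n f"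
  shows "computable n (\<lambda>xs. rec_nat c G (f xs))"
proof (rule computable_comp1[where F = "rec_nat c G"])
  have "computable (Suc 0) (\<lambda>xs. rec_nat c (\<lambda>k r. G k r) (hd xs))"
    using computable_rec_nat[OF computable_const[of 0 c], of "\<lambda>ys. G (ys ! 0) (ys ! 1)"] assms
    by (simp add: numeral_2_eq_2)
  then show "computable 1 (\<lambda>xs. rec_nat c G (xs ! 0))"
    by (subst computable_cong[of 1 _ "\<lambda>xs. rec_nat c (\<lambda>k r. G k r) (hd xs)"])
      (auto simp: hd_conv_nth length_Suc_conv)
qed (rule assms)

lemma computable_rec2:
  assumes "computable 1 (\<lambda>ys. F (ys ! 0))"
    "computable 3 (\<lambda>ys. G (ys ! 0) (ys ! 1) (ys ! 2))"
    "computable n f" "computable n g"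
  shows "computable n (\<lambda>xs. rec_nat (F (g xs)) (\<lambda>k r. G k r (g xs)) (f xs))"
proof (rule computable_comp2[where F = "\<lambda>x y. rec_nat (F y) (\<lambda>k r. G k r y) x"])
  have "computable (Suc 1) (\<lambda>xs. rec_nat (F (tl xs ! 0)) (\<lambda>k r. G k r (tl xs ! 0)) (hd xs))"
    using computable_rec_nat[OF assms(1), of "\<lambda>ys. G (ys ! 0) (ys ! 1) (ys ! 2)"] assms(2)
    by (simp add: numeral_2_eq_2 numeral_3_eq_3)
  then show "computable 2 (\<lambda>xs. rec_nat (F (xs ! 1)) (\<lambda>k r. G k r (xs ! 1)) (xs ! 0))"
    unfolding Suc_1
    by (rule iffD1[OF computable_cong, rotated]) (auto simp: length_Suc_conv numeral_2_eq_2)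
qed (rule assms)+

section \<open>Arithmetic by primitive recursion\<close>

lemma computable_add:
  assumes "computable n f" "computable n g"
  shows "computable n (\<lambda>xs. f xs + g xs)"
proof -
  have "rec_nat y (\<lambda>k r. Suc r) x = x + y" for x y
    by (induction x) auto
  moreover have "computable n (\<lambda>xs. rec_nat (g xs) (\<lambda>k r. Suc r) (f xs))"
    by (rule computable_rec2[of "\<lambda>y. y" "\<lambda>k r y. Suc r"])
      (auto intro!: computable_nth computable_Suc assms)
  ultimately show ?thesis
    by simp
qed

lemma computable_mult:
  assumes "computable n f" "computable n g"
  shows "computable n (\<lambda>xs. f xs * g xs)"
proof -
  have "rec_nat 0 (\<lambda>k r. y + r) x = x * y" for x y :: nat
    by (induction x) auto
  moreover have "computable n (\<lambda>xs. rec_nat 0 (\<lambda>k r. g xs + r) (f xs))"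
    by (rule computable_rec2[of "\<lambda>y. 0" "\<lambda>k r y. y + r"])
      (auto intro!: computable_nth computable_const computable_add assms)
  ultimately show ?thesis
    by simp
qed

text \<open>Truncated subtraction iterates the predecessor, which is itself a recursion that returns
  its counter \<open>k\<close>.\<close>

lemma computable_diff:
  assumes "computable n f" "computable n g"
  shows "computable n (\<lambda>xs. f xs - g xs)"
proof -
  have pred: "computable m (\<lambda>xs. h xs - Suc 0)" if "computable m h" for m h
  proof -
    have "rec_nat 0 (\<lambda>k r. k) x = x - Suc 0" for x
      by (cases x) auto
    moreover have "computable m (\<lambda>xs. rec_nat 0 (\<lambda>k r. k) (h xs))"
      by (rule computable_rec1) (auto intro!: computable_nth that)
    ultimately show ?thesis
      by simp
  qed
  have "rec_nat x (\<lambda>k r. r - Suc 0) y = x - y" for x y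
    by (induction y) auto
  moreover have "computable n (\<lambda>xs. rec_nat (f xs) (\<lambda>k r. r - Suc 0) (g xs))"
    by (rule computable_rec2[of "\<lambda>x. x" "\<lambda>k r x. r - Suc 0"])
      (auto intro!: computable_nth pred assms)
  ultimately show ?thesis
    by simp
qed

lemma computable_mod_2:
  assumes "computable n f"
  shows "computable n (\<lambda>xs. f xs mod 2)"
proof -
  have "rec_nat 0 (\<lambda>k r. 1 - r) x = x mod 2" for x :: nat
    by (induction x) (auto simp: mod_Suc)
  moreover have "computable n (\<lambda>xs. rec_nat 0 (\<lambda>k r. 1 - r) (f xs))"
    by (rule computable_rec1) (auto intro!: computable_nth computable_const computable_diff assms)
  ultimately show ?thesis
    by simp
qed

text \<open>\<open>Suc k div 2\<close> exceeds \<open>k div 2\<close> by exactly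
  \<open>k mod 2\<close>.\<close>

lemma computable_div_2:
  assumes "computable n f"
  shows "computable n (\<lambda>xs. f xs div 2)"
proof -
  have "rec_nat 0 (\<lambda>k r. r + k mod 2) x = x div 2" for x :: nat
    by (induction x) (simp_all, presburger)
  moreover have "computable n (\<lambda>xs. rec_nat 0 (\<lambda>k r. r + k mod 2) (f xs))"
    by (rule computable_rec1) (auto intro!: computable_nth computable_add computable_mod_2 assms)
  ultimately show ?thesis
    by simp
qed

section \<open>Decidable predicates and minimization\<close>

definition decidable :: "nat \<Rightarrow> (nat list \<Rightarrow> bool) \<Rightarrow> bool" where
  "decidable n P \<longleftrightarrow> computable n (\<lambda>xs. of_bool (P xs))"

lemma decidable_not:
  assumes "decidable n P"
  shows "decidable n (\<lambda>xs. \<not> P xs)"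
proof -
  have "computable n (\<lambda>xs. 1 - of_bool (P xs))"
    by (intro computable_diff computable_const assms[unfolded decidable_def])
  then show ?thesis
    unfolding decidable_def by (rule back_subst[of "computable n"]) auto
qed

lemma decidable_conj:
  assumes "decidable n P" "decidable n Q"
  shows "decidable n (\<lambda>xs. P xs \<and> Q xs)"
  using computable_mult assms unfolding decidable_def of_bool_conj .

lemma decidable_disj:
  assumes "decidable n P" "decidable n Q"
  shows "decidable n (\<lambda>xs. P xs \<or> Q xs)"
  using decidable_not[OF decidable_conj[OF assms[THEN decidable_not]]] by simp

text \<open>By truncation, \<open>1 - (x - y)\<close> is the truth value of
  \<open>x \<le> y\<close>.\<close>

lemma decidable_le_nat:
  assumes "computable n f" "computable n g"
  shows "decidable n (\<lambda>xs. f xs \<le> g xs)"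
proof -
  have "computable n (\<lambda>xs. 1 - (f xs - g xs))"
    by (intro computable_diff computable_const assms)
  then show ?thesis
    unfolding decidable_def by (rule back_subst[of "computable n"]) auto
qed

text \<open>Minimization looks for a zero, so it is applied to the truth value of the negation of
  \<open>P\<close>.\<close>

lemma computable_Least:
  assumes "decidable (Suc n) (\<lambda>ys. P (ys ! 0) (tl ys))" "\<And>xs. length xs = n \<Longrightarrow> \<exists>y. P y xs"
  shows "computable n (\<lambda>xs. LEAST y. P y xs)"
proof -
  obtain f where f: "total_recursive (Suc n) f"
      "\<And>ys. length ys = Suc n \<Longrightarrow> of_bool (\<not> P (ys ! 0) (tl ys)) = f ys"
    using decidable_not[OF assms(1)] by (auto simp: decidable_def computable_def)
  have P: "f (y # xs) = 0 \<longleftrightarrow> P y xs" if "length xs = n" for y xs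
    using f(2)[of "y # xs"] that by (auto split: if_splits)
  then have "total_recursive n (\<lambda>xs. LEAST y. f (y # xs) = 0)"
    using assms(2) by (intro total_recursive.minim f(1)) auto
  then show ?thesis
    using P unfolding computable_def by fastforce
qed

section \<open>Integer-valued computable functions\<close>

text \<open>A difference of two naturals is used in place of an integer code, so that ring
  operations and comparisons become arithmetic on naturals.\<close>

definition computable_int :: "nat \<Rightarrow> (nat list \<Rightarrow> int) \<Rightarrow> bool" where
  "computable_int n F \<longleftrightarrow>
     (\<exists>p q. computable n p \<and> computable n q \<and> (\<forall>xs. F xs = int (p xs) - int (q xs)))"

lemma computable_intI:
  assumes "computable n p" "computable n q" "\<And>xs. F xs = int (p xs) - int (q xs)"
  shows "computable_int n F"
  using assms by (auto simp: computable_int_def)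

lemma computable_int_of_nat: "computable n f \<Longrightarrow> computable_int n (\<lambda>xs. int (f xs))"
  by (rule computable_intI[OF _ computable_const[of n 0]]) auto

lemma computable_int_const: "computable_int n (\<lambda>xs. c)"
  by (rule computable_intI[OF computable_const[of n "nat c"] computable_const[of n "nat (- c)"]]) auto

lemma computable_int_uminus:
  assumes "computable_int n F"
  shows "computable_int n (\<lambda>xs. - F xs)"
proof -
  obtain p q where "computable n p" "computable n q" "\<And>xs. F xs = int (p xs) - int (q xs)"
    using assms by (auto simp: computable_int_def)
  then show ?thesis
    by (intro computable_intI[of n q p]) auto
qed

lemma computable_int_add:
  assumes "computable_int n F" "computable_int n G"
  shows "computable_int n (\<lambda>xs. F xs + G xs)"
proof -
  obtain p q p' q' where "computable n p" "computable n q" "\<And>xs. F xs = int (p xs) - int (q xs)"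
      "computable n p'" "computable n q'" "\<And>xs. G xs = int (p' xs) - int (q' xs)"
    using assms by (auto simp: computable_int_def)
  then show ?thesis
    by (intro computable_intI[of n "\<lambda>xs. p xs + p' xs" "\<lambda>xs. q xs + q' xs"] computable_add) auto
qed

lemma computable_int_diff:
  assumes "computable_int n F" "computable_int n G"
  shows "computable_int n (\<lambda>xs. F xs - G xs)"
  using computable_int_add[OF assms(1) computable_int_uminus[OF assms(2)]] by simp

lemma computable_int_mult:
  assumes "computable_int n F" "computable_int n G"
  shows "computable_int n (\<lambda>xs. F xs * G xs)"
proof -
  obtain p q p' q' where *: "computable n p" "computable n q" "\<And>xs. F xs = int (p xs) - int (q xs)"
      "computable n p'" "computable n q'" "\<And>xs. G xs = int (p' xs) - int (q' xs)"
    using assms by (auto simp: computable_int_def)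
  show ?thesis
    unfolding *(3,6)
    by (rule computable_intI[of n "\<lambda>xs. p xs * p' xs + q xs * q' xs"
          "\<lambda>xs. p xs * q' xs + q xs * p' xs"])
      (auto simp: algebra_simps intro!: computable_add computable_mult *(1,2,4,5))
qed

lemma decidable_le:
  assumes "computable_int n F" "computable_int n G"
  shows "decidable n (\<lambda>xs. F xs \<le> G xs)"
proof -
  obtain p q p' q' where *: "computable n p" "computable n q" "\<And>xs. F xs = int (p xs) - int (q xs)"
      "computable n p'" "computable n q'" "\<And>xs. G xs = int (p' xs) - int (q' xs)"
    using assms by (auto simp: computable_int_def)
  then have "decidable n (\<lambda>xs. p xs + q' xs \<le> p' xs + q xs)"
    by (intro decidable_le_nat computable_add)
  then show ?thesis
    by (rule back_subst[of "decidable n"]) (auto simp: *)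
qed

lemma decidable_less:
  assumes "computable_int n F" "computable_int n G"
  shows "decidable n (\<lambda>xs. F xs < G xs)"
  using decidable_not[OF decidable_le[OF assms(2,1)]] by (simp add: not_le)

lemma decidable_eq:
  assumes "computable_int n F" "computable_int n G"
  shows "decidable n (\<lambda>xs. F xs = G xs)"
  using decidable_conj[OF decidable_le[OF assms] decidable_le[OF assms(2,1)]]
  by (simp add: eq_iff)

lemma computable_int_if:
  assumes "decidable n P" "computable_int n F" "computable_int n G"
  shows "computable_int n (\<lambda>xs. if P xs then F xs else G xs)"
proof -
  have "computable_int n (\<lambda>xs. int (of_bool (P xs)) * F xs + int (of_bool (\<not> P xs)) * G xs)"
    using assms decidable_not[OF assms(1)]
    by (intro computable_int_add computable_int_mult computable_int_of_nat)
      (simp_all only: decidable_def)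
  then show ?thesis
    by (rule back_subst[of "computable_int n"]) auto
qed

lemma computable_int_abs: "computable_int n F \<Longrightarrow> computable_int n (\<lambda>xs. \<bar>F xs\<bar>)"
  unfolding abs_if
  by (intro computable_int_if decidable_less computable_int_const computable_int_uminus)

lemma int_decode_eq_div_mod:
  "int_decode e = (if e mod 2 = 0 then int (e div 2) else - int (e div 2) - 1)"
  by (auto simp: int_decode_def sum_decode_def even_iff_mod_2_eq_zero)

lemma computable_int_decode:
  assumes "computable n f"
  shows "computable_int n (\<lambda>xs. int_decode (f xs))"
proof -
  have "decidable n (\<lambda>xs. f xs mod 2 \<le> 0)"
    by (intro decidable_le_nat computable_mod_2 assms computable_const)
  then have "decidable n (\<lambda>xs. f xs mod 2 = 0)"
    by simp
  then show ?thesis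
    unfolding int_decode_eq_div_mod
    by (intro computable_int_if computable_int_diff computable_int_uminus computable_int_of_nat
        computable_div_2 computable_int_const assms)
qed

subsection \<open>Signs in a real quadratic field\<close>

text \<open>\<open>W + V * sqrt (b * b - 4 * a * c)\<close> is \<open>2 * a * a * d * d'\<close> times \<open>n / d + n' / d' * \<gamma>\<close>.\<close>

definition surd_pos :: "int \<Rightarrow> int \<Rightarrow> int \<Rightarrow> int \<Rightarrow> int \<Rightarrow> int \<Rightarrow> int \<Rightarrow> int \<Rightarrow> bool" where
  "surd_pos a b c \<sigma> n d n' d' \<longleftrightarrow>
     (let W = a * (2 * a * n * d' - n' * b * d); V = a * n' * \<sigma> * d
      in 0 < W * \<bar>W\<bar> + V * \<bar>V\<bar> * (b * b - 4 * a * c))"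

text \<open>The signed square is odd and strictly increasing, so inequalities can be squared
  whatever the signs.\<close>

lemma abs_mult_self_less_iff:
  fixes x y :: real
  shows "x * \<bar>x\<bar> < y * \<bar>y\<bar> \<longleftrightarrow> x < y"
proof -
  have *: "x * \<bar>x\<bar> < y * \<bar>y\<bar>" if "x < y" for x y :: real
  proof -
    consider "0 \<le> x" | "x < 0" "y \<le> 0" | "x < 0" "0 < y"
      by linarith
    then show ?thesis
    proof cases
      case 1
      then show ?thesis
        using that by (simp add: mult_strict_mono)
    next
      case 2
      then show ?thesis
        using that mult_strict_mono[of "- y" "- x" "- y" "- x"] by simp
    next
      case 3
      then have "x * \<bar>x\<bar> < 0" "0 < y * \<bar>y\<bar>"
        by (auto simp: zero_less_mult_iff)
      then show ?thesis
        by linarith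
    qed
  qed
  show ?thesis
    using *[of x y] *[of y x] by (cases x y rule: linorder_cases) auto
qed

text \<open>Taking signed squares in \<open>- (V * sqrt D) < W\<close> removes the root and leaves a
  comparison of integers.\<close>

lemma add_sqrt_pos_iff:
  fixes W V D :: int
  assumes "D \<ge> 0"
  shows "0 < real_of_int W + real_of_int V * sqrt (real_of_int D) \<longleftrightarrow>
    0 < W * \<bar>W\<bar> + V * \<bar>V\<bar> * D"
proof -
  define r where "r = sqrt (real_of_int D)"
  have r: "r * r = real_of_int D" "\<bar>r\<bar> = r"
    using assms by (simp_all add: r_def)
  have "0 < real_of_int W + real_of_int V * r \<longleftrightarrow> - (real_of_int V * r) < real_of_int W"
    by linarith
  also have "\<dots> \<longleftrightarrow> - (real_of_int V * r) * \<bar>- (real_of_int V * r)\<bar>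
      < real_of_int W * \<bar>real_of_int W\<bar>"
    by (rule abs_mult_self_less_iff[symmetric])
  also have "- (real_of_int V * r) * \<bar>- (real_of_int V * r)\<bar>
      = - (real_of_int V * \<bar>real_of_int V\<bar> * real_of_int D)"
    by (simp add: abs_mult r flip: r(1))
  also have "\<dots> < real_of_int W * \<bar>real_of_int W\<bar> \<longleftrightarrow>
      0 < real_of_int (W * \<bar>W\<bar> + V * \<bar>V\<bar> * D)"
    by auto
  finally show ?thesis
    unfolding r_def of_int_0_less_iff .
qed

text \<open>The derivative \<open>2 * a * \<gamma> + b\<close> squares to the discriminant, and
  \<open>\<sigma>\<close> is its sign.\<close>

lemma describes_sqrt:
  assumes "describes a b c \<sigma> \<gamma>"
  shows "0 \<le> b * b - 4 * a * c"
    and "2 * real_of_int a * \<gamma> = - real_of_int b + real_of_int \<sigma> * sqrt (real_of_int (b * b - 4 * a * c))"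
proof -
  define t where "t = 2 * real_of_int a * \<gamma> + real_of_int b"
  have root: "of_int a * \<gamma>\<^sup>2 + of_int b * \<gamma> + of_int c = 0" and \<sigma>: "of_int \<sigma> = sgn t"
    using assms by (auto simp: describes_def t_def)
  have "t * t = 4 * of_int a * (of_int a * \<gamma>\<^sup>2 + of_int b * \<gamma> + of_int c)
      + (of_int b * of_int b - 4 * of_int a * of_int c)"
    by (simp add: t_def algebra_simps power2_eq_square)
  then have D: "t * t = real_of_int (b * b - 4 * a * c)"
    by (simp add: root)
  then show "0 \<le> b * b - 4 * a * c"
    by (metis of_int_0_le_iff zero_le_square)
  have "sqrt (real_of_int (b * b - 4 * a * c)) = \<bar>t\<bar>"
    using D by (metis real_sqrt_abs2)
  then have "t = of_int \<sigma> * sqrt (real_of_int (b * b - 4 * a * c))"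
    unfolding \<sigma> by (simp add: mult_sgn_abs)
  then show "2 * real_of_int a * \<gamma> = - real_of_int b + real_of_int \<sigma> * sqrt (real_of_int (b * b - 4 * a * c))"
    by (simp add: t_def)
qed

lemma surd_pos_iff:
  assumes "describes a b c \<sigma> \<gamma>" "d > 0" "d' > 0"
  shows "surd_pos a b c \<sigma> n d n' d' \<longleftrightarrow>
    0 < real_of_int n / real_of_int d + real_of_int n' / real_of_int d' * \<gamma>"
proof -
  define W where "W = a * (2 * a * n * d' - n' * b * d)"
  define V where "V = a * n' * \<sigma> * d"
  define r where "r = sqrt (real_of_int (b * b - 4 * a * c))"
  define z where "z = real_of_int n / real_of_int d + real_of_int n' / real_of_int d' * \<gamma>"
  \<comment> \<open>The factor \<open>2 * a * d * d'\<close> would clear denominators but may be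
    negative; one more \<open>a\<close> makes it positive.\<close>
  define K where "K = 2 * (real_of_int a)\<^sup>2 * (real_of_int d * real_of_int d')"
  have "K > 0"
    unfolding K_def using assms by (intro mult_pos_pos) (auto simp: describes_def)
  have "real_of_int W + real_of_int V * r
      = real_of_int a * (2 * of_int a * of_int n * of_int d'
          + of_int n' * of_int d * (- of_int b + of_int \<sigma> * r))"
    by (simp add: W_def V_def algebra_simps)
  also have "- real_of_int b + of_int \<sigma> * r = 2 * of_int a * \<gamma>"
    using describes_sqrt(2)[OF assms(1)] by (simp add: r_def)
  also have "real_of_int a * (2 * of_int a * of_int n * of_int d'
          + of_int n' * of_int d * (2 * of_int a * \<gamma>))
      = K * z"
    using assms(2,3) by (simp add: K_def z_def field_simps power2_eq_square)
  finally have "0 < real_of_int W + real_of_int V * r \<longleftrightarrow> 0 < z"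
    using \<open>K > 0\<close> by (simp add: zero_less_mult_iff)
  then show ?thesis
    using add_sqrt_pos_iff[OF describes_sqrt(1)[OF assms(1)], of W V]
    by (simp add: surd_pos_def W_def V_def r_def z_def Let_def)
qed

text \<open>The tested quantity is affine in \<open>y\<close> with positive slope \<open>C\<close>.
  Here \<open>\<sigma>\<close> is any integer, because the search must also end on codes that
  describe no number.\<close>

lemma surd_pos_unbounded:
  assumes "a \<noteq> 0" "d > 0" "d' > 0" "0 \<le> b * b - 4 * a * c"
  shows "\<exists>y. surd_pos a b c \<sigma> (int y * d - n) d n' d'"
proof -
  define r where "r = sqrt (real_of_int (b * b - 4 * a * c))"
  define W where "W y = a * (2 * a * (int y * d - n) * d' - n' * b * d)" for y
  define V where "V = a * n' * \<sigma> * d"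
  define C where "C = 2 * (real_of_int a)\<^sup>2 * (real_of_int d * real_of_int d')"
  have "C > 0"
    unfolding C_def using assms by (intro mult_pos_pos) auto
  then obtain y where y: "(- (real_of_int (W 0) + real_of_int V * r)) < real y * C"
    using reals_Archimedean3 by blast
  have "real_of_int (W y) = real_of_int (W 0) + real y * C"
    by (simp add: W_def C_def algebra_simps power2_eq_square)
  then have "0 < real_of_int (W y) + real_of_int V * r"
    using y by linarith
  then have "surd_pos a b c \<sigma> (int y * d - n) d n' d'"
    using add_sqrt_pos_iff[OF assms(4), of "W y" V]
    by (simp add: surd_pos_def W_def V_def r_def Let_def)
  then show ?thesis ..
qed

section \<open>Computing the order and deciding the basis property\<close>

lemmas computable_intros =
  computable_int_add computable_int_diff computable_int_mult computable_int_uminus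
  computable_int_const computable_int_abs computable_int_decode computable_int_of_nat
  decidable_conj decidable_disj decidable_not decidable_less decidable_le decidable_eq

lemma decidable_surd_pos:
  assumes "computable_int m a" "computable_int m b" "computable_int m c" "computable_int m \<sigma>"
    "computable_int m n" "computable_int m d" "computable_int m n'" "computable_int m d'"
  shows "decidable m (\<lambda>xs. surd_pos (a xs) (b xs) (c xs) (\<sigma> xs) (n xs) (d xs) (n' xs) (d' xs))"
  unfolding surd_pos_def Let_def by (intro computable_intros assms)

text \<open>The entries \<open>x 0, \<dots>, x 3\<close> are the data \<open>a, b, c, \<sigma>\<close> of \<open>\<gamma>\<close>. Then come numerator and denominator of
  each coordinate: those of \<open>\<alpha>\<close> at \<open>4, \<dots>, 7\<close>, those of \<open>\<beta>\<close> at \<open>8, \<dots>, 11\<close>.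
  On inputs that do not describe a number the search is cut off at once, which keeps
  the minimization total.\<close>

definition order_test :: "nat \<Rightarrow> (nat \<Rightarrow> int) \<Rightarrow> bool" where
  "order_test y x \<longleftrightarrow>
     x 0 = 0 \<or> x 5 \<le> 0 \<or> x 7 \<le> 0 \<or> x 1 * x 1 - 4 * x 0 * x 2 < 0 \<or>
     surd_pos (x 0) (x 1) (x 2) (x 3) (int y * x 5 - x 4) (x 5) (- x 6) (x 7)"

text \<open>The three calls test the signs of \<open>- \<beta>\<close>, \<open>1 - \<beta>\<close>
  and \<open>2 - (\<alpha> + \<beta>)\<close>, the last over common denominators.\<close>

definition basis_test :: "(nat \<Rightarrow> int) \<Rightarrow> bool" where
  "basis_test x \<longleftrightarrow>
     surd_pos (x 0) (x 1) (x 2) (x 3) (- x 8) (x 9) (- x 10) (x 11) \<or>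
     surd_pos (x 0) (x 1) (x 2) (x 3) (x 9 - x 8) (x 9) (- x 10) (x 11) \<and>
     surd_pos (x 0) (x 1) (x 2) (x 3)
       (2 * x 5 * x 9 - x 4 * x 9 - x 8 * x 5) (x 5 * x 9)
       (- (x 6 * x 11 + x 10 * x 7)) (x 7 * x 11)"

lemma computable_order: "computable 12 (\<lambda>xs. LEAST y. order_test y (\<lambda>i. int_decode (xs ! i)))"
proof (rule computable_Least)
  \<comment> \<open>The search variable is the head of the list, so the input entries are shifted by
    one.\<close>
  have nth: "computable (Suc 12) (\<lambda>ys. tl ys ! i)" if "i < 12" for i
    by (subst computable_cong[of _ _ "\<lambda>ys. ys ! Suc i"])
      (use that in \<open>auto simp: nth_tl intro!: computable_nth\<close>)
  show "decidable (Suc 12) (\<lambda>ys. order_test (ys ! 0) (\<lambda>i. int_decode (tl ys ! i)))"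
    unfolding order_test_def
    by (intro computable_intros decidable_surd_pos nth computable_nth) simp_all
  fix xs :: "nat list"
  \<comment> \<open>Either a cut-off accepts every \<open>y\<close>, or the assumptions of
    \<open>surd_pos_unbounded\<close> hold.\<close>
  show "\<exists>y. order_test y (\<lambda>i. int_decode (xs ! i))"
    unfolding order_test_def using surd_pos_unbounded by (meson not_le not_less)
qed

lemma decidable_basis: "decidable 12 (\<lambda>xs. basis_test (\<lambda>i. int_decode (xs ! i)))"
  unfolding basis_test_def
  by (intro computable_intros decidable_surd_pos computable_nth) simp_all

lemma input_for_tests:
  assumes "input_for xs \<gamma> \<alpha> \<beta>"
  shows "length xs = 12"
    and "order_test y (\<lambda>i. int_decode (xs ! i)) \<longleftrightarrow> \<alpha> < real y"
    and "basis_test (\<lambda>i. int_decode (xs ! i)) \<longleftrightarrow> \<beta> < 0 \<or> \<beta> < 1 \<and> \<alpha> + \<beta> < 2"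
proof -
  obtain a b c \<sigma> p q u v where xs: "xs = input_code a b c \<sigma> p q u v"
    and desc: "describes a b c \<sigma> \<gamma>"
    and \<alpha>: "\<alpha> = of_rat p + of_rat q * \<gamma>" and \<beta>: "\<beta> = of_rat u + of_rat v * \<gamma>"
    using assms by (auto simp: input_for_def)
  have rat: "\<exists>n d. quotient_of t = (n, d) \<and> d > 0 \<and> real_of_rat t = real_of_int n / real_of_int d" for t
  proof -
    obtain n d where nd: "quotient_of t = (n, d)"
      by (cases "quotient_of t")
    then have "real_of_rat t = real_of_int n / real_of_int d"
      using quotient_of_div[OF nd] by (simp add: of_rat_divide)
    with nd quotient_of_denom_pos[OF nd] show ?thesis
      by blast
  qed
  obtain pn pd qn qd un ud vn vd where
    q: "quotient_of p = (pn, pd)" "quotient_of q = (qn, qd)"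
      "quotient_of u = (un, ud)" "quotient_of v = (vn, vd)"
    and pos: "pd > 0" "qd > 0" "ud > 0" "vd > 0"
    and r: "real_of_rat p = real_of_int pn / real_of_int pd"
      "real_of_rat q = real_of_int qn / real_of_int qd"
      "real_of_rat u = real_of_int un / real_of_int ud"
      "real_of_rat v = real_of_int vn / real_of_int vd"
    using rat[of p] rat[of q] rat[of u] rat[of v] by auto
  show "length xs = 12"
    by (simp add: xs input_code_def rat_data_def)
  define x where "x i = int_decode (xs ! i)" for i
  have x: "x 0 = a" "x 1 = b" "x (Suc 0) = b" "x 2 = c" "x 3 = \<sigma>" "x 4 = pn" "x 5 = pd" "x 6 = qn" "x 7 = qd"
      "x 8 = un" "x 9 = ud" "x 10 = vn" "x 11 = vd"
    by (simp_all add: x_def xs input_code_def rat_data_def q)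
  have "a \<noteq> 0"
    using desc by (simp add: describes_def)
  \<comment> \<open>On a genuine input no cut-off applies, and only the sign of
    \<open>y - \<alpha>\<close> is left to test.\<close>
  then have "order_test y x \<longleftrightarrow> surd_pos a b c \<sigma> (int y * pd - pn) pd (- qn) qd"
    using pos describes_sqrt(1)[OF desc] by (auto simp: order_test_def x)
  also have "\<dots> \<longleftrightarrow> \<alpha> < real y"
    unfolding surd_pos_iff[OF desc pos(1,2)] using pos by (auto simp: \<alpha> r diff_divide_distrib)
  finally show "order_test y (\<lambda>i. int_decode (xs ! i)) \<longleftrightarrow> \<alpha> < real y"
    by (simp add: x_def[abs_def])
  have "real_of_int (2 * pd * ud - pn * ud - un * pd) / real_of_int (pd * ud)
      + real_of_int (- (qn * vd + vn * qd)) / real_of_int (qd * vd) * \<gamma> = 2 - (\<alpha> + \<beta>)"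
    using pos by (simp add: \<alpha> \<beta> r field_simps)
  then have "surd_pos a b c \<sigma> (2 * pd * ud - pn * ud - un * pd) (pd * ud)
      (- (qn * vd + vn * qd)) (qd * vd) \<longleftrightarrow> \<alpha> + \<beta> < 2"
    using surd_pos_iff[OF desc, of "pd * ud" "qd * vd"] pos by simp
  moreover have "surd_pos a b c \<sigma> (- un) ud (- vn) vd \<longleftrightarrow> \<beta> < 0"
    unfolding surd_pos_iff[OF desc pos(3,4)] by (auto simp: \<beta> r)
  moreover have "surd_pos a b c \<sigma> (ud - un) ud (- vn) vd \<longleftrightarrow> \<beta> < 1"
    unfolding surd_pos_iff[OF desc pos(3,4)] using pos by (auto simp: \<beta> r diff_divide_distrib)
  ultimately have "basis_test x \<longleftrightarrow> \<beta> < 0 \<or> \<beta> < 1 \<and> \<alpha> + \<beta> < 2"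
    by (simp add: basis_test_def x)
  then show "basis_test (\<lambda>i. int_decode (xs ! i)) \<longleftrightarrow> \<beta> < 0 \<or> \<beta> < 1 \<and> \<alpha> + \<beta> < 2"
    by (simp add: x_def[abs_def])
qed

theorem theorem12:
  "(\<forall>(\<gamma> :: real) (\<alpha> :: real) (\<beta> :: real). quadratic_irrational \<gamma> \<longrightarrow>
        \<alpha> \<in> rat_adjoin \<gamma> \<longrightarrow> \<beta> \<in> rat_adjoin \<gamma> \<longrightarrow> \<alpha> \<notin> \<rat> \<longrightarrow> \<alpha> > 0 \<longrightarrow>
      (\<exists>h\<ge>1. asymptotic_additive_basis_of_order (beatty \<alpha> \<beta>) h)) \<and>
   (\<exists>f. total_recursive 12 f \<and>
      (\<forall>(\<gamma> :: real) (\<alpha> :: real) (\<beta> :: real) xs. quadratic_irrational \<gamma> \<longrightarrow>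
        \<alpha> \<in> rat_adjoin \<gamma> \<longrightarrow> \<beta> \<in> rat_adjoin \<gamma> \<longrightarrow> \<alpha> \<notin> \<rat> \<longrightarrow> \<alpha> > 0 \<longrightarrow> input_for xs \<gamma> \<alpha> \<beta> \<longrightarrow>
         f xs = (LEAST h. h \<ge> 1 \<and> asymptotic_additive_basis_of_order (beatty \<alpha> \<beta>) h))) \<and>
   (\<exists>g. total_recursive 12 g \<and>
      (\<forall>(\<gamma> :: real) (\<alpha> :: real) (\<beta> :: real) xs. quadratic_irrational \<gamma> \<longrightarrow>
        \<alpha> \<in> rat_adjoin \<gamma> \<longrightarrow> \<beta> \<in> rat_adjoin \<gamma> \<longrightarrow> \<alpha> \<notin> \<rat> \<longrightarrow> \<alpha> > 0 \<longrightarrow> input_for xs \<gamma> \<alpha> \<beta> \<longrightarrow>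
         g xs = (if additive_basis (beatty \<alpha> \<beta>) then 1 else 0)))"
proof (intro conjI allI impI)
  fix \<gamma> \<alpha> \<beta> :: real
  assume "\<alpha> \<notin> \<rat>" "\<alpha> > 0"
  moreover have "\<alpha> < real (Suc (nat \<lfloor>\<alpha>\<rfloor>))"
    by linarith
  ultimately show "\<exists>h\<ge>1. asymptotic_additive_basis_of_order (beatty \<alpha> \<beta>) h"
    by (intro exI[of _ "Suc (nat \<lfloor>\<alpha>\<rfloor>)"]) (simp add: asymptotic_basis_beatty_iff)
next
  obtain f where f: "total_recursive 12 f"
      "\<And>xs. length xs = 12 \<Longrightarrow> f xs = (LEAST y. order_test y (\<lambda>i. int_decode (xs ! i)))"
    using computable_order unfolding computable_def by metis
  have "f xs = (LEAST h. h \<ge> 1 \<and> asymptotic_additive_basis_of_order (beatty \<alpha> \<beta>) h)"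
    if "\<alpha> \<notin> \<rat>" "\<alpha> > 0" "input_for xs \<gamma> \<alpha> \<beta>" for \<gamma> \<alpha> \<beta> xs
  proof -
    \<comment> \<open>Since \<open>\<alpha> > 0\<close>, the condition \<open>h \<ge> 1\<close>
      follows from \<open>\<alpha> < h\<close>, so both minima are taken over the same set.\<close>
    have "\<alpha> < real h \<longleftrightarrow> h \<ge> 1 \<and> asymptotic_additive_basis_of_order (beatty \<alpha> \<beta>) h" for h
      using that(1,2) by (cases h) (simp_all add: asymptotic_basis_beatty_iff)
    then show ?thesis
      by (simp add: f(2) input_for_tests[OF that(3)])
  qed
  with f(1) show "\<exists>f. total_recursive 12 f \<and>
      (\<forall>\<gamma> \<alpha> \<beta> xs. quadratic_irrational \<gamma> \<longrightarrow>
        \<alpha> \<in> rat_adjoin \<gamma> \<longrightarrow> \<beta> \<in> rat_adjoin \<gamma> \<longrightarrow> \<alpha> \<notin> \<rat> \<longrightarrow> \<alpha> > 0 \<longrightarrow> input_for xs \<gamma> \<alpha> \<beta> \<longrightarrow>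
         f xs = (LEAST h. h \<ge> 1 \<and> asymptotic_additive_basis_of_order (beatty \<alpha> \<beta>) h))"
    by blast
next
  obtain g where g: "total_recursive 12 g"
      "\<And>xs. length xs = 12 \<Longrightarrow> g xs = of_bool (basis_test (\<lambda>i. int_decode (xs ! i)))"
    using decidable_basis unfolding decidable_def computable_def by metis
  have "g xs = (if additive_basis (beatty \<alpha> \<beta>) then 1 else 0)"
    if "\<alpha> \<notin> \<rat>" "\<alpha> > 0" "input_for xs \<gamma> \<alpha> \<beta>" for \<gamma> \<alpha> \<beta> xs
    unfolding additive_basis_beatty_iff[OF that(1,2)]
    by (simp add: g(2) input_for_tests[OF that(3)])
  with g(1) show "\<exists>g. total_recursive 12 g \<and>
      (\<forall>\<gamma> \<alpha> \<beta> xs. quadratic_irrational \<gamma> \<longrightarrow>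
        \<alpha> \<in> rat_adjoin \<gamma> \<longrightarrow> \<beta> \<in> rat_adjoin \<gamma> \<longrightarrow> \<alpha> \<notin> \<rat> \<longrightarrow> \<alpha> > 0 \<longrightarrow> input_for xs \<gamma> \<alpha> \<beta> \<longrightarrow>
         g xs = (if additive_basis (beatty \<alpha> \<beta>) then 1 else 0))"
    by blast
qed

end
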